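(* Let $(\varepsilon_n)_{n\le0}$ be a sequence (indexed by the integers $n\le 0$) of independent $\{-1,1\}$-valued random variables such that $$\sum_{n=-\infty}^{0}\min\big(\mathbb{P}[\varepsilon_n=1],\mathbb{P}[\varepsilon_n=-1]\big)=\infty.$$ Then there is a predictable process $(h_n)_{n\le0}$ of $\{-1,1\}$-valued random variables such that $(h_n\varepsilon_n)_{n\le0}$ is an i.i.d. sequence of symmetric Bernoulli random variables.
   Context: Predictability is with respect to the natural filtration $(\mathcal{F}_n)_{n\le0}$, $\mathcal{F}_n=\sigma(\varepsilon_k: k\le n)$; that is, $h_n$ is $\mathcal{F}_{n-1}$-measurable for every $n\le0$. A $\{-1,1\}$-valued random variable $X$ is called symmetric Bernoulli if $\mathbb{P}[X=1]=\mathbb{P}[X=-1]=1/2$. *)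

theory Defs
  imports "HOL-Probability.Probability"
begin

definition natural_filtration ::
  "'w measure \<Rightarrow> (int \<Rightarrow> 'w \<Rightarrow> real) \<Rightarrow> int \<Rightarrow> 'w measure"
where
  "natural_filtration M X n =
     sigma (space M) (\<Union>k\<in>{..n}. {X k -` A \<inter> space M | A. A \<in> sets borel})"

text \<open>Processes are functions on all of \<^typ>\<open>int\<close>, but only the times \<open>n \<le> 0\<close> count:
  no requirement is imposed at positive times.
  The \<open>\<sigma>\<close>-algebras are not completed.\<close>

definition predictable ::
  "'w measure \<Rightarrow> (int \<Rightarrow> 'w \<Rightarrow> real) \<Rightarrow> (int \<Rightarrow> 'w \<Rightarrow> real) \<Rightarrow> bool"
where
  "predictable M X h \<longleftrightarrow>
     (\<forall>n\<le>0. h n \<in> borel_measurable (natural_filtration M X (n - 1)))"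

definition sign_valued :: "'w measure \<Rightarrow> (int \<Rightarrow> 'w \<Rightarrow> real) \<Rightarrow> bool"
where
  "sign_valued M X \<longleftrightarrow> (\<forall>n\<le>0. \<forall>\<omega>\<in>space M. X n \<omega> \<in> {-1, 1})"

definition symmetric_bernoulli :: "'w measure \<Rightarrow> ('w \<Rightarrow> real) \<Rightarrow> bool"
where
  "symmetric_bernoulli M X \<longleftrightarrow>
     X \<in> borel_measurable M \<and>
     (\<forall>\<omega>\<in>space M. X \<omega> \<in> {-1, 1}) \<and>
     \<P>(\<omega> in M. X \<omega> = 1) = 1 / 2 \<and>
     \<P>(\<omega> in M. X \<omega> = -1) = 1 / 2"

end

theory Submission
  imports Defs
begin

text \<open>Split the times into disjoint infinite sets \<open>A n \<subseteq> {..<n}\<close> along each of which the series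
  still diverges. Divergence makes the joint law of \<open>\<epsilon> k\<close>, \<open>k \<in> A n\<close>, atomless, so some event
  generated by these variables has probability \<open>1/2\<close>; let \<open>h n\<close> be the sign of that event. For
  independence, consider the least index \<open>n\<close> of a finite set of times: the remaining \<open>h k * \<epsilon> k\<close>
  and \<open>\<epsilon> n\<close> involve no variable with index in \<open>A n\<close>, so \<open>h n\<close> is a fair sign independent of all
  of them.\<close>

section \<open>Splitting a divergent series into divergent subseries\<close>

text \<open>Cut the series into consecutive blocks of sum at least 1 and deal the blocks out by a
  pairing function: each set receives infinitely many blocks, and no block is dealt twice.\<close>

lemma divergent_series_disjoint_split:
  fixes a :: "nat \<Rightarrow> real"
  assumes nonneg: "\<And>n. 0 \<le> a n" and diverges: "\<not> summable a"
  obtains A :: "nat \<Rightarrow> nat set"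
  where "disjoint_family A" "\<And>m. A m \<subseteq> {m<..}"
    "\<And>m C. \<exists>F\<subseteq>A m. finite F \<and> C \<le> sum a F"
proof -
  \<comment> \<open>Otherwise \<open>sum a {..<n} + 1\<close> bounds all partial sums, and a
    nonnegative series with bounded partial sums converges.\<close>
  have "\<exists>k>n. 1 \<le> sum a {n..<k}" for n
  proof (rule ccontr)
    assume "\<not> ?thesis"
    then have *: "sum a {n..<k} \<le> 1" if "n < k" for k using that by force
    have "sum a {..<k} \<le> sum a {..<n} + 1" for k
    proof (cases "n < k")
      case True
      then have "{..<k} = {..<n} \<union> {n..<k}" by auto
      then have "sum a {..<k} = sum a {..<n} + sum a {n..<k}"
        by (simp add: sum.union_disjoint ivl_disj_int)
      then show ?thesis using *[OF True] by simp
    next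
      case False
      then have "sum a {..<k} \<le> sum a {..<n}" using nonneg by (intro sum_mono2) auto
      then show ?thesis by simp
    qed
    then have "sum a {..k} \<le> sum a {..<n} + 1" for k by (metis lessThan_Suc_atMost)
    with nonneg have "summable a" by (rule bounded_imp_summable)
    with diverges show False ..
  qed
  then obtain nxt where nxt: "\<And>n. n < nxt n" "\<And>n. 1 \<le> sum a {n..<nxt n}" by metis
  define N where "N j = (nxt ^^ j) 0" for j
  have N_Suc: "N (Suc j) = nxt (N j)" for j by (simp add: N_def)
  have mono: "strict_mono N" using nxt(1) by (intro strict_monoI_Suc) (simp add: N_Suc)
  have le_N: "j \<le> N j" for j by (rule strict_mono_imp_increasing[OF mono])
  define I where "I j = {N j..<N (Suc j)}" for j
  have disj: "I i \<inter> I j = {}" if "i < j" for i j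
  proof -
    have "N (Suc i) \<le> N j" using that mono by (simp add: strict_mono_less_eq)
    then show ?thesis by (auto simp: I_def)
  qed
  then have disj: "I i \<inter> I j = {}" if "i \<noteq> j" for i j
    using that by (metis Int_commute linorder_neqE_nat)
  have sum_I: "1 \<le> sum a (I j)" for j using nxt(2) by (simp add: I_def N_Suc)
  \<comment> \<open>Only \<open>l > m\<close> is used so that \<open>A m\<close> lies beyond
    \<open>m\<close>: block \<open>j\<close> starts at \<open>N j \<ge> j\<close>, and
    \<open>prod_encode (m, l) \<ge> l > m\<close>.\<close>
  define A where "A m = (\<Union>l\<in>{m<..}. I (prod_encode (m, l)))" for m
  show thesis
  proof
    show "disjoint_family A"
    proof (unfold disjoint_family_on_def, intro ballI impI)
      fix m m' :: nat assume "m \<noteq> m'"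
      then have "I (prod_encode (m, l)) \<inter> I (prod_encode (m', l')) = {}" for l l'
        by (intro disj) (simp add: prod_encode_eq)
      then show "A m \<inter> A m' = {}" unfolding A_def by blast
    qed
    show "A m \<subseteq> {m<..}" for m
    proof
      fix i assume "i \<in> A m"
      then obtain l where "m < l" "N (prod_encode (m, l)) \<le> i" by (auto simp: A_def I_def)
      then show "i \<in> {m<..}"
        using le_N[of "prod_encode (m, l)"] le_prod_encode_2[of l m] by simp
    qed
    show "\<exists>F\<subseteq>A m. finite F \<and> C \<le> sum a F" for m C
    proof -
      obtain L :: nat where L: "C \<le> real L" using real_arch_simple by blast
      let ?F = "\<Union>l\<in>{m<..m+L}. I (prod_encode (m, l))"
      have "C \<le> (\<Sum>l\<in>{m<..m+L}. 1)" using L by simp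
      also have "\<dots> \<le> (\<Sum>l\<in>{m<..m+L}. sum a (I (prod_encode (m, l))))"
        by (intro sum_mono sum_I)
      also have "\<dots> = sum a ?F"
        by (intro sum.UNION_disjoint[symmetric] ballI impI disj)
          (simp_all add: I_def prod_encode_eq)
      finally show ?thesis by (intro exI[of _ ?F]) (auto simp: A_def I_def)
    qed
  qed
qed

section \<open>Encoding binary sequences as real numbers\<close>

text \<open>At the first place \<open>n\<close> of disagreement the expansions differ by
  \<open>(1/3)^n\<close>, while all later digits together contribute at most half of that. In base 2
  the two could balance, which is why base 3 is used.\<close>

lemma ternary_digits_unique:
  fixes c d :: "nat \<Rightarrow> bool"
  assumes eq: "(\<Sum>i. of_bool (c i) * (1/3::real)^i) = (\<Sum>i. of_bool (d i) * (1/3)^i)"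
  shows "c = d"
proof (rule ccontr)
  assume "c \<noteq> d"
  then have ex: "\<exists>n. c n \<noteq> d n" by auto
  define n where "n = (LEAST n. c n \<noteq> d n)"
  have n: "c n \<noteq> d n" and less: "\<And>i. i < n \<Longrightarrow> c i = d i"
    using LeastI_ex[OF ex] not_less_Least[of _ "\<lambda>n. c n \<noteq> d n"] unfolding n_def by blast+
  have geo: "summable (\<lambda>i. (1/3::real)^i)" by (simp add: summable_geometric)
  have summ: "summable (\<lambda>i. of_bool (b i) * (1/3::real)^i)" for b :: "nat \<Rightarrow> bool"
    by (rule summable_comparison_test[OF _ geo]) auto
  define f where "f i = (of_bool (c i) - of_bool (d i)) * (1/3::real)^i" for i
  have f_summ: "summable f"
    using summable_diff[OF summ summ] unfolding f_def by (simp add: left_diff_distrib)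
  have "suminf f = 0"
    using suminf_diff[OF summ[of c] summ[of d]] eq unfolding f_def by (simp add: left_diff_distrib)
  \<comment> \<open>The terms before \<open>n\<close> vanish, so the tail after \<open>n\<close>
    must cancel \<open>f n\<close> exactly.\<close>
  moreover have "suminf f = (\<Sum>i. f (i + Suc n)) + sum f {..<Suc n}"
    by (rule suminf_split_initial_segment[OF f_summ])
  moreover have "sum f {..<Suc n} = f n"
    using less by (simp add: f_def)
  ultimately have tail: "(\<Sum>i. f (i + Suc n)) = - f n" by simp
  have shifted: "(\<lambda>i. (1/3::real)^(i + Suc n)) sums ((1/3)^n / 2)"
    using sums_mult[OF geometric_sums[of "1/3::real"], of "(1/3)^Suc n"]
    by (simp add: power_add mult.commute)
  have "norm (\<Sum>i. f (i + Suc n)) \<le> (\<Sum>i. (1/3::real)^(i + Suc n))"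
    using shifted by (intro norm_suminf_le) (auto simp: f_def sums_iff abs_mult)
  also have "\<dots> = (1/3)^n / 2" using shifted by (rule sums_unique[symmetric])
  finally have "\<bar>f n\<bar> \<le> (1/3)^n / 2" using tail by simp
  moreover have "\<bar>f n\<bar> = (1/3)^n" using n by (cases "c n") (auto simp: f_def)
  ultimately show False by simp
qed

section \<open>Sigma-algebras generated by subfamilies\<close>

text \<open>Extends \<open>natural_filtration\<close>, the case \<open>S = {..n}\<close>, to
  arbitrary index sets such as the scattered sets \<open>A n\<close> and their complements.\<close>

definition generated_algebra :: "'w measure \<Rightarrow> ('i \<Rightarrow> 'w \<Rightarrow> real) \<Rightarrow> 'i set \<Rightarrow> 'w measure" where
  "generated_algebra M X S =
     sigma (space M) (\<Union>k\<in>S. {X k -` A \<inter> space M | A. A \<in> sets borel})"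

lemma space_generated_algebra [simp]: "space (generated_algebra M X S) = space M"
  by (simp add: generated_algebra_def space_measure_of_conv)

lemma sets_generated_algebra:
  "sets (generated_algebra M X S) =
     sigma_sets (space M) (\<Union>k\<in>S. {X k -` A \<inter> space M | A. A \<in> sets borel})"
  unfolding generated_algebra_def by (rule sets_measure_of) auto

lemma sets_generated_algebra_mono:
  "S \<subseteq> T \<Longrightarrow> sets (generated_algebra M X S) \<subseteq> sets (generated_algebra M X T)"
  unfolding sets_generated_algebra by (intro sigma_sets_mono') auto

lemma measurable_generated_algebra:
  "k \<in> S \<Longrightarrow> X k \<in> borel_measurable (generated_algebra M X S)"
  by (rule measurableI) (auto simp: sets_generated_algebra intro!: sigma_sets.Basic)

lemma sets_generated_algebra_subset:
  assumes "\<And>k. k \<in> S \<Longrightarrow> X k \<in> borel_measurable M"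
  shows "sets (generated_algebra M X S) \<subseteq> sets M"
  unfolding sets_generated_algebra using assms by (intro sets.sigma_sets_subset) auto

context prob_space
begin

text \<open>The preimages under a single variable form an intersection-stable family, so
  independence passes from the variables to the sigma-algebras generated by disjoint groups of them.
  The two groups are indexed by \<open>bool\<close>.\<close>

lemma indep_set_generated_algebra:
  assumes indep: "indep_vars (\<lambda>_. borel) X I" and sub: "S \<subseteq> I" "T \<subseteq> I" "S \<inter> T = {}"
  shows "indep_set (sets (generated_algebra M X S)) (sets (generated_algebra M X T))"
proof -
  let ?E = "\<lambda>k. {X k -` A \<inter> space M | A. A \<in> sets borel}"
  have "indep_sets ?E I" using indep by (simp add: indep_vars_def2)
  then have "indep_sets ?E (\<Union>b\<in>UNIV. case_bool S T b)"
    by (rule indep_sets_mono_index[rotated]) (use sub in \<open>auto split: bool.splits\<close>)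
  then have "indep_sets (\<lambda>b. sigma_sets (space M) (\<Union>k\<in>case_bool S T b. ?E k)) UNIV"
  proof (rule indep_sets_collect_sigma)
    show "Int_stable (?E k)" for k
    proof (rule Int_stableI)
      fix a b assume "a \<in> ?E k" "b \<in> ?E k"
      then obtain P Q where "P \<in> sets borel" "Q \<in> sets borel"
        "a = X k -` P \<inter> space M" "b = X k -` Q \<inter> space M" by blast
      then show "a \<inter> b \<in> ?E k" by (intro CollectI exI[of _ "P \<inter> Q"]) auto
    qed
    show "disjoint_family_on (case_bool S T) UNIV"
      using sub by (auto simp: disjoint_family_on_def split: bool.splits)
  qed
  then show ?thesis
    unfolding indep_set_def sets_generated_algebra
    by (rule indep_sets_cong[THEN iffD1, rotated -1]) (auto split: bool.splits)
qed

section \<open>Events of probability one half\<close>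

text \<open>Without atoms the distribution function is continuous; it tends to 0 and 1 at the two
  ends, so the intermediate value theorem applies.\<close>

lemma atomless_imp_median:
  fixes X :: "'a \<Rightarrow> real"
  assumes X: "random_variable borel X" and atomless: "\<And>x. prob {\<omega>\<in>space M. X \<omega> = x} = 0"
  shows "\<exists>t. prob {\<omega>\<in>space M. X \<omega> \<le> t} = 1/2"
proof -
  interpret D: real_distribution "distr M borel X" using X by (rule real_distribution_distr)
  let ?F = "cdf (distr M borel X)"
  have F: "?F t = prob {\<omega>\<in>space M. X \<omega> \<le> t}" for t
    using X by (auto simp: cdf_def2 measure_distr intro!: arg_cong[where f = prob])
  have cont: "isCont ?F t" for t
    using X atomless[of t] D.isCont_cdf[of t]
    by (auto simp: measure_distr vimage_def Int_def conj_commute)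
  obtain a where a: "?F a < 1/2"
    using order_tendstoD(2)[OF D.cdf_lim_at_bot, of "1/2"]
    by (auto simp: eventually_at_bot_linorder)
  obtain b where b: "1/2 < ?F b"
    using order_tendstoD(1)[OF D.cdf_lim_at_top_prob, of "1/2"]
    by (auto simp: eventually_at_top_linorder)
  have "a \<le> b" using a b D.cdf_nondecreasing[of b a] by linarith
  then obtain t where "?F t = 1/2"
    using IVT[of ?F a "1/2" b] a b cont by auto
  then show ?thesis using F by auto
qed

text \<open>All signs are encoded in one real variable \<open>Y\<close>. Fixing its value fixes
  every sign, which has probability at most \<open>exp (- C)\<close> for every \<open>C > 0\<close>
  by independence and divergence. Hence \<open>Y\<close> is atomless and \<open>{Y \<le> t}\<close>
  is fair for some \<open>t\<close>.\<close>

lemma exists_fair_event: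
  fixes X :: "'i :: countable \<Rightarrow> 'a \<Rightarrow> real"
  assumes indep: "indep_vars (\<lambda>_. borel) X A"
    and signs: "\<And>k \<omega>. k \<in> A \<Longrightarrow> \<omega> \<in> space M \<Longrightarrow> X k \<omega> \<in> {-1, 1}"
    and diverges: "\<And>C. \<exists>F\<subseteq>A. finite F \<and>
      C \<le> (\<Sum>k\<in>F. min (prob {\<omega>\<in>space M. X k \<omega> = 1}) (prob {\<omega>\<in>space M. X k \<omega> = -1}))"
  shows "\<exists>B\<in>sets (generated_algebra M X A). prob B = 1/2"
proof -
  let ?G = "generated_algebra M X A"
  let ?m = "\<lambda>k. min (prob {\<omega>\<in>space M. X k \<omega> = 1}) (prob {\<omega>\<in>space M. X k \<omega> = -1})"
  have rv: "random_variable borel (X k)" if "k \<in> A" for k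
    using indep that by (auto simp: indep_vars_def)
  \<comment> \<open>The sign of \<open>X k\<close> is read off at position \<open>to_nat k\<close>;
    positions that decode to an index outside \<open>A\<close> carry the digit 0.\<close>
  define c where "c \<omega> n \<longleftrightarrow> (from_nat n :: 'i) \<in> A \<and> X (from_nat n) \<omega> = 1" for \<omega> n
  define Y where "Y \<omega> = (\<Sum>n. of_bool (c \<omega> n) * (1/3::real)^n)" for \<omega>
  have "Measurable.pred ?G (\<lambda>\<omega>. c \<omega> n)" for n
  proof (cases "(from_nat n :: 'i) \<in> A")
    case True
    note [measurable] = measurable_generated_algebra[OF True, of X M]
    show ?thesis using True unfolding c_def by measurable
  qed (simp add: c_def)
  note [measurable] = this
  have Y: "Y \<in> borel_measurable ?G"
    unfolding Y_def by measurable
  have Y_M: "random_variable borel Y"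
    using Y sets_generated_algebra_subset[of A X M] rv
    by (auto simp: measurable_def)
  have "prob {\<omega>\<in>space M. Y \<omega> = x} = 0" for x
  \<comment> \<open>If \<open>x\<close> is attained, any such point \<open>\<omega>0\<close> serves
    as reference: its signs are the only ones possible on \<open>{Y = x}\<close>.\<close>
  proof (cases "\<exists>\<omega>0\<in>space M. Y \<omega>0 = x")
    case True
    then obtain \<omega>0 where \<omega>0: "\<omega>0 \<in> space M" "Y \<omega>0 = x" by blast
    have determined: "X k \<omega> = X k \<omega>0" if "\<omega> \<in> space M" "Y \<omega> = x" "k \<in> A" for \<omega> k
    proof -
      have "c \<omega> = c \<omega>0"
        using that \<omega>0 unfolding Y_def by (intro ternary_digits_unique) simp
      then have "c \<omega> (to_nat k) = c \<omega>0 (to_nat k)" by simp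
      then show ?thesis using signs[of k \<omega>] signs[of k \<omega>0] that \<omega>0 by (auto simp: c_def)
    qed
    have le_exp: "prob {\<omega>\<in>space M. Y \<omega> = x} \<le> exp (- C)" if "0 < C" for C
    proof -
      obtain F where F: "F \<subseteq> A" "finite F" "C \<le> sum ?m F" using diverges by blast
      \<comment> \<open>An empty sum could not reach \<open>C > 0\<close>. The intersection and
        product rules below ask for a nonempty index set.\<close>
      with that have "F \<noteq> {}" by auto
      \<comment> \<open>The opposite sign has probability at least \<open>?m k\<close>, and
        \<open>1 - x \<le> exp (- x)\<close>.\<close>
      have factor: "prob (X k -` {X k \<omega>0} \<inter> space M) \<le> exp (- ?m k)" if "k \<in> F" for k
      proof -
        have k: "k \<in> A" using F that by auto
        note [measurable] = rv[OF k]
        have "?m k \<le> prob {\<omega>\<in>space M. X k \<omega> = - X k \<omega>0}"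
          using signs[OF k \<omega>0(1)] by auto
        also have "\<dots> = prob (space M - (X k -` {X k \<omega>0} \<inter> space M))"
          using signs[OF k] signs[OF k \<omega>0(1)] by (intro arg_cong[where f = prob]) force
        also have "\<dots> = 1 - prob (X k -` {X k \<omega>0} \<inter> space M)"
          by (rule prob_compl) measurable
        finally show ?thesis using exp_ge_add_one_self[of "- ?m k"] by linarith
      qed
      have "prob {\<omega>\<in>space M. Y \<omega> = x} \<le> prob (\<Inter>k\<in>F. X k -` {X k \<omega>0} \<inter> space M)"
        using F \<open>F \<noteq> {}\<close> rv determined
        by (intro finite_measure_mono sets.finite_INT) (auto intro: measurable_sets)
      also have "\<dots> = (\<Prod>k\<in>F. prob (X k -` {X k \<omega>0} \<inter> space M))"
        using F \<open>F \<noteq> {}\<close> by (intro indep_varsD[OF indep]) auto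
      also have "\<dots> \<le> (\<Prod>k\<in>F. exp (- ?m k))"
        using factor by (intro prod_mono) auto
      also have "\<dots> = exp (- sum ?m F)"
        using F by (simp add: exp_sum flip: sum_negf)
      also have "\<dots> \<le> exp (- C)" using F by simp
      finally show ?thesis .
    qed
    have "prob {\<omega>\<in>space M. Y \<omega> = x} \<le> 0"
    proof (rule field_le_epsilon)
      fix r :: real assume "0 < r"
      \<comment> \<open>This choice is positive and makes \<open>exp (- C) \<le> r\<close>.\<close>
      define C where "C = max 1 (- ln r)"
      have "prob {\<omega>\<in>space M. Y \<omega> = x} \<le> exp (- C)" by (rule le_exp) (simp add: C_def)
      also have "\<dots> \<le> exp (ln r)" unfolding C_def by simp
      finally show "prob {\<omega>\<in>space M. Y \<omega> = x} \<le> 0 + r" using \<open>0 < r\<close> by simp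
    qed
    then show ?thesis by (simp add: measure_le_0_iff)
  next
    case False
    then have "{\<omega>\<in>space M. Y \<omega> = x} = {}" by blast
    then show ?thesis by (metis measure_empty)
  qed
  then obtain t where "prob {\<omega>\<in>space M. Y \<omega> \<le> t} = 1/2"
    using atomless_imp_median[OF Y_M] by blast
  moreover have "{\<omega>\<in>space M. Y \<omega> \<le> t} \<in> sets ?G"
  proof -
    have "{\<omega>\<in>space ?G. Y \<omega> \<le> t} \<in> sets ?G" using Y by measurable
    then show ?thesis by simp
  qed
  ultimately show ?thesis by blast
qed

section \<open>Multiplication by an independent fair sign\<close>

text \<open>The event \<open>B\<close> halves each piece of \<open>E\<close> on which
  \<open>V\<close> is constant, so flipping \<open>V\<close> off \<open>B\<close> spreads
  \<open>E\<close> evenly over both values. As \<open>E\<close> ranges over \<open>G\<close>, this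
  says that the product is a fair sign independent of \<open>G\<close>.\<close>

lemma prob_fair_sign_times:
  fixes V :: "'a \<Rightarrow> real"
  assumes indep: "indep_set \<B> (sets G)" and B: "B \<in> \<B>" "prob B = 1/2"
    and space: "space G = space M" and E: "E \<in> sets G"
    and V: "V \<in> borel_measurable G" "\<And>\<omega>. \<omega> \<in> space M \<Longrightarrow> V \<omega> \<in> {-1, 1}"
  shows "prob {\<omega>\<in>E. (if \<omega> \<in> B then 1 else -1) * V \<omega> \<in> P} =
    (of_bool (1 \<in> P) + of_bool (-1 \<in> P)) / 2 * prob E"
proof -
  let ?D = "\<lambda>s. {\<omega>\<in>E. V \<omega> = s}"
  have events: "\<B> \<subseteq> events" "sets G \<subseteq> events" using indep by (auto simp: indep_sets2_eq)
  have EM: "E \<subseteq> space M" using sets.sets_into_space[OF E] space by simp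
  have D: "?D s \<in> sets G" for s
  proof -
    have "?D s = E \<inter> (V -` {s} \<inter> space G)" using EM space by auto
    also have "\<dots> \<in> sets G" by (rule sets.Int[OF E measurable_sets[OF V(1)]]) simp
    finally show ?thesis .
  qed
  have in_events: "B \<in> events" "?D s \<in> events" "E \<in> events" for s
    using B D E events by auto
  have BD: "prob (B \<inter> ?D s) = prob (?D s) / 2" for s
    using indep_setD[OF indep B(1) D] B(2) by simp
  have DB: "prob (?D s - B) = prob (?D s) / 2" for s
    using finite_measure_Diff'[of "?D s" B] in_events BD[of s] by (simp add: Int_commute)
  have split: "prob E = prob (?D 1) + prob (?D (-1))"
  proof -
    have "E = ?D 1 \<union> ?D (-1)" using V(2) EM by blast
    then have "prob E = prob (?D 1 \<union> ?D (-1))" by simp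
    also have "\<dots> = prob (?D 1) + prob (?D (-1))"
      using in_events by (intro finite_measure_Union) auto
    finally show ?thesis .
  qed
  define W where "W \<omega> = (if \<omega> \<in> B then 1 else -1) * V \<omega>" for \<omega>
  define H where "H s = {\<omega>\<in>E. W \<omega> = s}" for s
  \<comment> \<open>The product equals \<open>s\<close> if \<open>V = s\<close> on \<open>B\<close>
    or \<open>V = -s\<close> off \<open>B\<close>; these contribute half of \<open>?D s\<close> and
    half of \<open>?D (-s)\<close>.\<close>
  have H_eq: "H s = (B \<inter> ?D s) \<union> (?D (-s) - B)" for s
    by (auto simp: H_def W_def minus_equation_iff)
  have H_events: "H s \<in> events" for s
    unfolding H_eq using in_events by auto
  have half: "prob (H s) = prob E / 2" if "s \<in> {-1, 1}" for s
  proof -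
    have "prob (H s) = prob (B \<inter> ?D s) + prob (?D (-s) - B)"
      unfolding H_eq using in_events by (intro finite_measure_Union) auto
    also have "\<dots> = prob (?D s) / 2 + prob (?D (-s)) / 2" by (simp only: BD DB)
    also have "\<dots> = prob E / 2" using that split by auto
    finally show ?thesis .
  qed
  have W: "W \<omega> \<in> {-1, 1}" if "\<omega> \<in> E" for \<omega>
    using V(2)[of \<omega>] EM that by (auto simp: W_def)
  have "\<omega> \<in> {\<omega>\<in>E. W \<omega> \<in> P} \<longleftrightarrow>
      \<omega> \<in> (if 1 \<in> P then H 1 else {}) \<union> (if -1 \<in> P then H (-1) else {})" for \<omega>
    using W[of \<omega>] by (auto simp: H_def)
  then have "{\<omega>\<in>E. W \<omega> \<in> P} =
      (if 1 \<in> P then H 1 else {}) \<union> (if -1 \<in> P then H (-1) else {})" by blast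
  also have "prob \<dots> = prob (if 1 \<in> P then H 1 else {}) + prob (if -1 \<in> P then H (-1) else {})"
    by (rule finite_measure_Union) (use H_events in \<open>auto simp: H_def\<close>)
  also have "\<dots> = (of_bool (1 \<in> P) + of_bool (-1 \<in> P)) / 2 * prob E"
    by (simp add: half)
  finally show ?thesis unfolding W_def .
qed

end

theorem theoremA4:
  fixes M :: "'w measure" and \<epsilon> :: "int \<Rightarrow> 'w \<Rightarrow> real"
  assumes "prob_space M"
    and "prob_space.indep_vars M (\<lambda>_. borel) \<epsilon> {..0}"
    and "sign_valued M \<epsilon>"
    and "(\<Sum>\<^sub>\<infinity>n\<in>{..0}. ennreal (min (\<P>(\<omega> in M. \<epsilon> n \<omega> = 1)) (\<P>(\<omega> in M. \<epsilon> n \<omega> = -1)))) = \<infinity>"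
  shows "\<exists>h :: int \<Rightarrow> 'w \<Rightarrow> real.
           predictable M \<epsilon> h \<and>
           sign_valued M h \<and>
           prob_space.indep_vars M (\<lambda>_. borel) (\<lambda>n \<omega>. h n \<omega> * \<epsilon> n \<omega>) {..0} \<and>
           (\<forall>n\<le>0. symmetric_bernoulli M (\<lambda>\<omega>. h n \<omega> * \<epsilon> n \<omega>))"
proof -

  \<comment> \<open>Divergent disjoint index sets in the past\<close>
  interpret prob_space M by fact
  note indep = assms(2)
  have sign: "\<epsilon> n \<omega> \<in> {-1, 1}" if "n \<le> 0" "\<omega> \<in> space M" for n \<omega>
    using assms(3) that by (auto simp: sign_valued_def)
  have rv: "random_variable borel (\<epsilon> n)" if "n \<le> 0" for n
    using indep that by (auto simp: indep_vars_def)
  define a where "a n = min (\<P>(\<omega> in M. \<epsilon> n \<omega> = 1)) (\<P>(\<omega> in M. \<epsilon> n \<omega> = -1))" for n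
  have a_nonneg: "0 \<le> a n" for n by (simp add: a_def)
  have bij: "bij_betw (\<lambda>i. - int i) UNIV {..0}"
    by (rule bij_betwI[where g = "\<lambda>n. nat (- n)"]) auto
  \<comment> \<open>If the real series converged, the extended sum in the hypothesis would be its
    finite value.\<close>
  have not_summable: "\<not> summable (\<lambda>i. a (- int i))"
  proof
    assume "summable (\<lambda>i. a (- int i))"
    then have "(\<lambda>i. a (- int i)) summable_on UNIV"
      using a_nonneg by (intro norm_summable_imp_summable_on) simp
    then have "a summable_on {..0}"
      using summable_on_reindex_bij_betw[OF bij, of a] by simp
    then have "ennreal (infsum a {..0}) = (\<Sum>\<^sub>\<infinity>n\<in>{..0}. ennreal (a n))"
      using a_nonneg
      by (simp add: infsum_nonneg_is_SUPREMUM_ennreal nonneg_infsum_complete sum_ennreal)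
    then show False using assms(4) unfolding a_def[symmetric] by simp
  qed
  obtain A' :: "nat \<Rightarrow> nat set" where A': "disjoint_family A'" "\<And>m. A' m \<subseteq> {m<..}"
    "\<And>m C. \<exists>F\<subseteq>A' m. finite F \<and> C \<le> (\<Sum>i\<in>F. a (- int i))"
    by (rule divergent_series_disjoint_split[where a = "\<lambda>i. a (- int i)", OF a_nonneg not_summable])
      (rule that)
  \<comment> \<open>Reflection turns indices beyond \<open>nat (- n)\<close> into times strictly
    before \<open>n\<close>, for \<open>n \<le> 0\<close>.\<close>
  define A where "A n = (\<lambda>i. - int i) ` A' (nat (- n))" for n
  have A_less: "A n \<subseteq> {..<n}" if "n \<le> 0" for n
    using A'(2)[of "nat (- n)"] that by (auto simp: A_def)
  have A_disj: "A m \<inter> A n = {}" if "m \<le> 0" "n \<le> 0" "m \<noteq> n" for m n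
  proof -
    have "A' (nat (- m)) \<inter> A' (nat (- n)) = {}"
      using that by (intro disjoint_family_onD[OF A'(1)]) auto
    then show ?thesis by (auto simp: A_def)
  qed
  have A_div: "\<exists>F\<subseteq>A n. finite F \<and> C \<le> sum a F" for n C
  proof -
    obtain F where F: "F \<subseteq> A' (nat (- n))" "finite F" "C \<le> (\<Sum>i\<in>F. a (- int i))"
      using A'(3) by blast
    have "sum a ((\<lambda>i. - int i) ` F) = (\<Sum>i\<in>F. a (- int i))"
      by (subst sum.reindex) (auto simp: inj_on_def)
    then show ?thesis using F by (intro exI[of _ "(\<lambda>i. - int i) ` F"]) (auto simp: A_def)
  qed

  \<comment> \<open>Construction of the process\<close>
  have "\<exists>B\<in>sets (generated_algebra M \<epsilon> (A n)). prob B = 1/2" if "n \<le> 0" for n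
  proof (rule exists_fair_event)
    have sub: "A n \<subseteq> {..0}" using A_less[OF that] that by auto
    show "indep_vars (\<lambda>_. borel) \<epsilon> (A n)" using indep_vars_subset[OF indep sub] .
    show "\<epsilon> k \<omega> \<in> {-1, 1}" if "k \<in> A n" "\<omega> \<in> space M" for k \<omega>
      using sign that sub by blast
  qed (use A_div in \<open>simp add: a_def\<close>)
  then obtain B where B: "\<And>n. n \<le> 0 \<Longrightarrow> B n \<in> sets (generated_algebra M \<epsilon> (A n))"
    "\<And>n. n \<le> 0 \<Longrightarrow> prob (B n) = 1/2" by metis
  define h :: "int \<Rightarrow> 'w \<Rightarrow> real" where "h n \<omega> = (if \<omega> \<in> B n then 1 else -1)" for n \<omega>
  define \<eta> where "\<eta> n \<omega> = h n \<omega> * \<epsilon> n \<omega>" for n \<omega>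
  \<comment> \<open>Later \<open>S = {..n - 1}\<close> yields predictability, and
    \<open>S = {..0} - A m\<close> serves the independence argument.\<close>
  have h_meas: "h n \<in> borel_measurable (generated_algebra M \<epsilon> S)" if "n \<le> 0" "A n \<subseteq> S" for n S
  proof -
    have [measurable]: "B n \<in> sets (generated_algebra M \<epsilon> S)"
      using B(1)[OF that(1)] sets_generated_algebra_mono[OF that(2)] by blast
    show ?thesis unfolding h_def by measurable
  qed
  have \<eta>_meas: "\<eta> n \<in> borel_measurable (generated_algebra M \<epsilon> S)"
    if "n \<le> 0" "A n \<subseteq> S" "n \<in> S" for n S
    unfolding \<eta>_def using h_meas measurable_generated_algebra that
    by (intro borel_measurable_times) auto
  have \<eta>_rv: "random_variable borel (\<eta> n)" if "n \<le> 0" for n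
  proof -
    have "\<eta> n \<in> borel_measurable (generated_algebra M \<epsilon> {..0})"
      using that A_less[OF that] by (intro \<eta>_meas) auto
    then show ?thesis
      using sets_generated_algebra_subset[of "{..0}" \<epsilon> M] rv by (auto simp: measurable_def)
  qed

  \<comment> \<open>Joint law of the products\<close>
  \<comment> \<open>The mass of \<open>P\<close> under the symmetric Bernoulli law.\<close>
  define q :: "real set \<Rightarrow> real" where "q P = (of_bool (1 \<in> P) + of_bool (-1 \<in> P)) / 2" for P
  have peel: "prob {\<omega>\<in>E. \<eta> n \<omega> \<in> P} = q P * prob E"
    if "n \<le> 0" "E \<in> sets (generated_algebra M \<epsilon> ({..0} - A n))" for n E P
  proof -
    have A: "A n \<subseteq> {..0}" "n \<in> {..0} - A n" using A_less[OF that(1)] that(1) by auto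
    have indep': "indep_set (sets (generated_algebra M \<epsilon> (A n)))
        (sets (generated_algebra M \<epsilon> ({..0} - A n)))"
      using A by (intro indep_set_generated_algebra[OF indep]) auto
    show ?thesis
      unfolding \<eta>_def h_def q_def
      by (rule prob_fair_sign_times[OF indep' B[OF that(1)] space_generated_algebra that(2)
          measurable_generated_algebra[where X = \<epsilon>, OF A(2)] sign[OF that(1)]])
  qed
  have joint: "prob {\<omega>\<in>space M. \<forall>n\<in>F. \<eta> n \<omega> \<in> P n} = (\<Prod>n\<in>F. q (P n))"
    if "finite F" "F \<subseteq> {..0}" "\<And>n. n \<in> F \<Longrightarrow> P n \<in> sets borel" for F P
    using that
  \<comment> \<open>Each new index \<open>m\<close> lies below all of \<open>F\<close>, so no
    \<open>n\<close> in \<open>F\<close> belongs to \<open>A m\<close>. A set \<open>A n\<close> may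
    contain \<open>m\<close> itself, which is harmless because \<open>m\<close> stays in
    \<open>{..0} - A m\<close>.\<close>
  proof (induction F rule: finite_linorder_min_induct)
    case empty
    then show ?case by (simp add: prob_space)
  next
    case (insert m F)
    let ?G = "generated_algebra M \<epsilon> ({..0} - A m)"
    let ?E = "{\<omega>\<in>space M. \<forall>n\<in>F. \<eta> n \<omega> \<in> P n}"
    have "{\<omega>\<in>space ?G. \<eta> n \<omega> \<in> P n} \<in> sets ?G" if "n \<in> F" for n
    proof -
      have n: "m < n" "n \<le> 0" "m \<le> 0" "P n \<in> sets borel"
        using that insert.hyps insert.prems by auto
      then have "A n \<subseteq> {..0} - A m" "n \<in> {..0} - A m"
        using A_less[of n] A_less[of m] A_disj[of n m] by auto
      from measurable_sets[OF \<eta>_meas[OF n(2) this] n(4)]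
      show ?thesis by (simp add: vimage_def Int_def conj_commute)
    qed
    then have "{\<omega>\<in>space ?G. \<forall>n\<in>F. \<eta> n \<omega> \<in> P n} \<in> sets ?G"
      using insert.hyps(1) by (rule sets.sets_Collect_finite_All)
    then have E: "?E \<in> sets ?G" by simp
    have "{\<omega>\<in>space M. \<forall>n\<in>insert m F. \<eta> n \<omega> \<in> P n} = {\<omega>\<in>?E. \<eta> m \<omega> \<in> P m}" by auto
    then show ?case
      using peel[OF _ E, of "P m"] insert.IH insert.hyps insert.prems by auto
  qed
  \<comment> \<open>The marginals come from taking \<open>E\<close> to be the whole space; with them
    \<open>joint\<close> becomes the product formula for independence.\<close>
  have single: "prob {\<omega>\<in>space M. \<eta> n \<omega> \<in> P} = q P" if "n \<le> 0" for n P
    using peel[OF that, of "space M" P] sets.top[of "generated_algebra M \<epsilon> ({..0} - A n)"]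
    by (simp add: prob_space)
  have "indep_vars (\<lambda>_. borel) \<eta> {..0}"
    unfolding indep_vars_def2
  proof (intro conjI ballI indep_setsI)
    fix S J assume J: "J \<noteq> {}" "J \<subseteq> {..0::int}" "finite J"
      and S: "\<forall>n\<in>J. S n \<in> {\<eta> n -` P \<inter> space M | P. P \<in> sets borel}"
    then have "\<forall>n\<in>J. \<exists>P. P \<in> sets borel \<and> S n = \<eta> n -` P \<inter> space M" by blast
    from bchoice[OF this] obtain P
      where P: "\<And>n. n \<in> J \<Longrightarrow> P n \<in> sets borel \<and> S n = \<eta> n -` P n \<inter> space M"
      by blast
    have "(\<Inter>n\<in>J. S n) = {\<omega>\<in>space M. \<forall>n\<in>J. \<eta> n \<omega> \<in> P n}" using P J by auto
    moreover have "prob (S n) = q (P n)" if "n \<in> J" for n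
    proof -
      have "S n = {\<omega>\<in>space M. \<eta> n \<omega> \<in> P n}" using P[OF that] by auto
      then show ?thesis using single that J by auto
    qed
    ultimately show "prob (\<Inter>n\<in>J. S n) = (\<Prod>n\<in>J. prob (S n))"
      using joint[of J P] J P by simp
  qed (use \<eta>_rv in \<open>auto intro: measurable_sets\<close>)
  moreover have "predictable M \<epsilon> h"
  proof -
    have "natural_filtration M \<epsilon> n = generated_algebra M \<epsilon> {..n}" for n
      by (simp add: natural_filtration_def generated_algebra_def)
    moreover have "A n \<subseteq> {..n - 1}" if "n \<le> 0" for n using A_less[OF that] by auto
    ultimately show ?thesis using h_meas by (auto simp: predictable_def)
  qed
  moreover have "sign_valued M h" by (simp add: sign_valued_def h_def)
  moreover have "symmetric_bernoulli M (\<eta> n)" if "n \<le> 0" for n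
  proof -
    have "\<eta> n \<omega> \<in> {-1, 1}" if "\<omega> \<in> space M" for \<omega>
      using sign[OF \<open>n \<le> 0\<close> that] by (auto simp: \<eta>_def h_def)
    then show ?thesis
      using \<eta>_rv[OF that] single[OF that, of "{1}"] single[OF that, of "{-1}"]
      by (simp add: symmetric_bernoulli_def q_def)
  qed
  ultimately show ?thesis unfolding \<eta>_def by blast
qed

end
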